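(* For every integer $v\ge 19$ we have $$\frac{A_2(v,4;3)}{2^{2v-6}+\left[{v-3\atop 2}\right]_2}\ \ge\ 1.3056.$$
   Context: $A_q(v,d;k)$ denotes the maximum cardinality of a set of $k$-dimensional subspaces of $\mathbb{F}_q^v$ such that any two distinct members $U,W$ satisfy $\mathrm{d}_{\mathrm s}(U,W)\ge d$, where $\mathrm{d}_{\mathrm s}(U,W)=\dim(U)+\dim(W)-2\dim(U\cap W)$. $\left[{a\atop b}\right]_q=\prod_{i=1}^{b}\frac{q^{a-b+i}-1}{q^i-1}$ is the $q$-binomial coefficient. *)

theory Defs
  imports Complex_Main "HOL-Library.Z2" "HOL-Library.Function_Algebras"
begin

text \<open>
  Vectors over a field are functions \<open>nat \<Rightarrow> 'f\<close> with pointwise operations, so that the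
  dimension \<open>v\<close> of the ambient space can remain an ordinary natural number.
\<close>

definition vscale :: "'f::field \<Rightarrow> (nat \<Rightarrow> 'f) \<Rightarrow> nat \<Rightarrow> 'f" where
  "vscale c x = (\<lambda>i. c * x i)"

global_interpretation fvec: vector_space "vscale :: 'f::field \<Rightarrow> (nat \<Rightarrow> 'f) \<Rightarrow> nat \<Rightarrow> 'f"
  by unfold_locales (auto simp: vscale_def fun_eq_iff algebra_simps)

definition coord_space :: "nat \<Rightarrow> (nat \<Rightarrow> 'f::field) set" where
  "coord_space v = {x. \<forall>i\<ge>v. x i = 0}"

lemma subspace_coord_space: "fvec.subspace (coord_space v)"
  by (auto simp: fvec.subspace_def coord_space_def vscale_def)

lemma dim_coord_space: "fvec.dim (coord_space v :: (nat \<Rightarrow> 'f::field) set) = v"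
proof -
  define e :: "nat \<Rightarrow> nat \<Rightarrow> 'f" where "e = (\<lambda>i j. if j = i then 1 else 0)"
  have inj: "inj_on e {..<v}"
    by (auto simp: inj_on_def e_def fun_eq_iff split: if_splits)
  have sum_e: "(\<Sum>i<v. vscale (u i) (e i)) j = (if j < v then u j else 0)" for u j
    by (induction v) (auto simp: vscale_def e_def less_Suc_eq)
  have indep: "fvec.independent (e ` {..<v})"
  proof (rule fvec.independent_if_scalars_zero)
    fix f x
    assume 0: "(\<Sum>x\<in>e ` {..<v}. vscale (f x) x) = 0" and "x \<in> e ` {..<v}"
    then obtain j where j: "j < v" "x = e j" by auto
    from 0 have "(\<Sum>i<v. vscale (f (e i)) (e i)) = 0"
      by (simp add: sum.reindex[OF inj])
    then show "f x = 0"
      using sum_e[of "\<lambda>i. f (e i)" j] j by simp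
  qed simp
  have "x \<in> fvec.span (e ` {..<v})" if "x \<in> coord_space v" for x
  proof -
    have "x = (\<Sum>i<v. vscale (x i) (e i))"
    proof
      show "x j = (\<Sum>i<v. vscale (x i) (e i)) j" for j
        using that by (subst sum_e) (auto simp: coord_space_def)
    qed
    also have "\<dots> \<in> fvec.span (e ` {..<v})"
      by (intro fvec.span_sum fvec.span_scale fvec.span_base) auto
    finally show ?thesis .
  qed
  moreover have "e ` {..<v} \<subseteq> coord_space v"
    by (auto simp: coord_space_def e_def)
  ultimately show ?thesis
    using fvec.dim_unique[of "e ` {..<v}" "coord_space v" v] indep
    by (auto simp: card_image[OF inj])
qed

lemma UNIV_bit: "(UNIV :: bit set) = {0, 1}"
  by auto

instance bit :: finite
  by standard (simp add: UNIV_bit)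

lemma card_UNIV_bit: "card (UNIV :: bit set) = 2"
  by (simp add: UNIV_bit)

definition subspace_dist :: "(nat \<Rightarrow> 'f::field) set \<Rightarrow> (nat \<Rightarrow> 'f) set \<Rightarrow> int" where
  "subspace_dist U W = int (fvec.dim U) + int (fvec.dim W) - 2 * int (fvec.dim (U \<inter> W))"

definition constant_dim_code :: "nat \<Rightarrow> nat \<Rightarrow> nat \<Rightarrow> (nat \<Rightarrow> 'f::field) set set \<Rightarrow> bool" where
  "constant_dim_code v d k C \<longleftrightarrow>
     (\<forall>U\<in>C. fvec.subspace U \<and> U \<subseteq> coord_space v \<and> fvec.dim U = k) \<and>
     (\<forall>U\<in>C. \<forall>W\<in>C. U \<noteq> W \<longrightarrow> int d \<le> subspace_dist U W)"

text \<open>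
  The field of order \<open>q\<close> in \<open>A\<^sub>q(v,d;k)\<close> is given by a type argument; \<open>A\<^sub>2\<close> uses \<open>TYPE(bit)\<close>.
  The maximum is well defined because a finite field admits only finitely many codes.
\<close>

definition max_code_size :: "'f::{field,finite} itself \<Rightarrow> nat \<Rightarrow> nat \<Rightarrow> nat \<Rightarrow> nat" where
  "max_code_size F v d k = Max {card C | C :: (nat \<Rightarrow> 'f) set set. constant_dim_code v d k C}"

lemma finite_constant_dim_codes:
  "finite {C :: (nat \<Rightarrow> 'f::{field,finite}) set set. constant_dim_code v d k C}"
proof -
  have "finite (coord_space v :: (nat \<Rightarrow> 'f) set)"
    using finite_set_of_finite_funs[of "{..<v}" "UNIV :: 'f set" 0]
    by (rule rev_finite_subset) (auto simp: coord_space_def)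
  then have "finite (Pow (Pow (coord_space v :: (nat \<Rightarrow> 'f) set)))" by simp
  then show ?thesis
    by (rule rev_finite_subset) (auto simp: constant_dim_code_def)
qed

lemma constant_dim_code_empty: "constant_dim_code v d k {}"
  by (simp add: constant_dim_code_def)

text \<open>
  The integer exponent keeps the product formula meaningful for \<open>a < b\<close>, where a factor vanishes.
\<close>

definition q_binomial :: "real \<Rightarrow> nat \<Rightarrow> nat \<Rightarrow> real" where
  "q_binomial q a b = (\<Prod>i=1..b. (q powi (int a - int b + int i) - 1) / (q ^ i - 1))"

end

theory Submission
  imports Defs "HOL-Library.FuncSet" "HOL-Number_Theory.Pocklington"
begin

text \<open>
  The linkage construction extends every codeword of a code in dimension \<open>m\<close> by the \<open>4\<^sup>n\<close> matrices of a
  rank-distance code with three rows and \<open>n\<close> columns, so \<open>A\<^sub>2(m + n,4;3) \<ge> 4\<^sup>n A\<^sub>2(m,4;3)\<close> for \<open>n \<ge> 3\<close>.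
  It is applied to \<open>m = 13\<close>, where the Steiner system \<open>S\<^sub>2[2,3,13]\<close> of Braun, Etzion, Ostergard, Vardy
  and Wassermann is a code of size \<open>1597245\<close>; since \<open>1597245 / 2\<^sup>2\<^sup>6\<close> is about \<open>1.30564 * 7 / 384\<close> and the
  denominator of the claim is at most \<open>7 / 384 * 4\<^sup>v\<close>, this is enough.

  The Steiner system consists of fifteen orbits of planes of the field of order \<open>2\<^sup>1\<^sup>3\<close> under
  multiplication by field elements and the Frobenius map. Two points \<open>u, w\<close> lie in at most one
  plane because the quotients \<open>u / w\<close> of distinct points of the fifteen base planes, taken
  together with their Frobenius conjugates, are pairwise distinct.
\<close>

section \<open>Planes over the field with two elements\<close>

lemma vscale_bit [simp]: "vscale (0::bit) x = 0" "vscale (1::bit) x = x"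
  by (simp_all add: vscale_def fun_eq_iff)

lemma add_self_bit_vector [simp]: "x + x = (0 :: nat \<Rightarrow> bit)"
  by (simp add: fun_eq_iff)

lemma add_eq_0_bit_vector [simp]: "x + y = 0 \<longleftrightarrow> x = (y :: nat \<Rightarrow> bit)"
  by (metis add_self_bit_vector add_right_cancel)

lemma finite_coord_space: "finite (coord_space n :: (nat \<Rightarrow> bit) set)"
  and card_coord_space: "card (coord_space n :: (nat \<Rightarrow> bit) set) = 2 ^ n"
proof -
  have "bij_betw (\<lambda>x i. if i < n then x i else 0)
          (PiE {..<n} (\<lambda>_. UNIV)) (coord_space n :: (nat \<Rightarrow> bit) set)"
    by (rule bij_betw_byWitness[where f' = "\<lambda>x. restrict x {..<n}"])
       (auto simp: coord_space_def fun_eq_iff PiE_def extensional_def)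
  moreover have "finite (PiE {..<n} (\<lambda>_. UNIV :: bit set))"
    by (rule finite_PiE) auto
  ultimately show "finite (coord_space n :: (nat \<Rightarrow> bit) set)"
    "card (coord_space n :: (nat \<Rightarrow> bit) set) = 2 ^ n"
    by (auto simp: bij_betw_finite card_PiE card_UNIV_bit dest!: bij_betw_same_card)
qed

text \<open>Coordinates rather than a span: over two elements, membership then reduces to case
  splits on three bits.\<close>

definition plane :: "(nat \<Rightarrow> bit) \<Rightarrow> (nat \<Rightarrow> bit) \<Rightarrow> (nat \<Rightarrow> bit) \<Rightarrow> (nat \<Rightarrow> bit) set" where
  "plane a b c = {vscale x a + vscale y b + vscale z c | x y z. True}"

definition indep :: "(nat \<Rightarrow> bit) \<Rightarrow> (nat \<Rightarrow> bit) \<Rightarrow> (nat \<Rightarrow> bit) \<Rightarrow> bool" where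
  "indep a b c \<longleftrightarrow>
     (\<forall>x y z. vscale x a + vscale y b + vscale z c = 0 \<longrightarrow> x = 0 \<and> y = 0 \<and> z = 0)"

lemma plane_eq_span: "plane a b c = fvec.span {a, b, c}"
proof -
  have "v \<in> plane a b c \<longleftrightarrow> v \<in> fvec.span {a, b, c}" for v
  proof
    assume "v \<in> plane a b c"
    then show "v \<in> fvec.span {a, b, c}"
      unfolding plane_def
      by (auto intro!: fvec.span_add fvec.span_scale intro: fvec.span_base)
  next
    assume "v \<in> fvec.span {a, b, c}"
    then obtain x y z where "v - vscale x a - vscale y b - vscale z c = 0"
      by (auto simp: fvec.span_breakdown_eq)
    then have "v = vscale x a + vscale y b + vscale z c"
      by (simp add: algebra_simps)
    then show "v \<in> plane a b c" by (auto simp: plane_def)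
  qed
  then show ?thesis by blast
qed

lemma indep_iff:
  "indep a b c \<longleftrightarrow> fvec.independent {a, b, c} \<and> card {a, b, c} = 3"
proof
  assume ind: "indep a b c"
  have 1: "x = 0 \<and> y = 0 \<and> z = 0" if "vscale x a + vscale y b + vscale z c = 0" for x y z
    using ind that by (auto simp: indep_def)
  have "a \<noteq> b" "a \<noteq> c" "b \<noteq> c" using 1[of 1 1 0] 1[of 1 0 1] 1[of 0 1 1] by auto
  then have "card {a, b, c} = 3" by simp
  moreover have "fvec.independent {a, b, c}"
  proof (rule fvec.independent_if_scalars_zero)
    fix f x
    assume 0: "(\<Sum>x\<in>{a, b, c}. vscale (f x) x) = 0" and x: "x \<in> {a, b, c}"
    have "vscale (f a) a + vscale (f b) b + vscale (f c) c = 0"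
      using 0 \<open>a \<noteq> b\<close> \<open>a \<noteq> c\<close> \<open>b \<noteq> c\<close> by (simp add: add.assoc del: add_eq_0_bit_vector)
    from 1[OF this] x show "f x = 0" by auto
  qed simp
  ultimately show "fvec.independent {a, b, c} \<and> card {a, b, c} = 3" by blast
next
  assume *: "fvec.independent {a, b, c} \<and> card {a, b, c} = 3"
  then have d: "a \<noteq> b" "a \<noteq> c" "b \<noteq> c" by (auto simp: card_insert_if split: if_splits)
  show "indep a b c"
    unfolding indep_def
  proof (intro allI impI)
    fix x y z
    assume eq: "vscale x a + vscale y b + vscale z c = 0"
    define f where "f v = (if v = a then x else if v = b then y else z)" for v
    have "(\<Sum>v\<in>{a, b, c}. vscale (f v) v) = 0"
      using eq d by (simp add: f_def add.assoc del: add_eq_0_bit_vector)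
    then have "f v = 0" if "v \<in> {a, b, c}" for v
      using * that fvec.independentD[of "{a, b, c}" "{a, b, c}" f v] by blast
    from this[of a] this[of b] this[of c] d show "x = 0 \<and> y = 0 \<and> z = 0"
      by (auto simp: f_def)
  qed
qed

lemma subspace_plane: "fvec.subspace (plane a b c)"
  by (simp add: plane_eq_span)

lemma dim_plane: "indep a b c \<Longrightarrow> fvec.dim (plane a b c) = 3"
  unfolding plane_eq_span indep_iff by (simp add: fvec.dim_eq_card_independent)

lemma plane_subset: "fvec.subspace S \<Longrightarrow> a \<in> S \<Longrightarrow> b \<in> S \<Longrightarrow> c \<in> S \<Longrightarrow> plane a b c \<subseteq> S"
  by (simp add: plane_eq_span fvec.span_minimal)

lemma obtain_plane:
  assumes "fvec.subspace U" "fvec.dim U = 3"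
  obtains a b c where "indep a b c" "U = plane a b c"
proof -
  obtain B where B: "B \<subseteq> U" "fvec.independent B" "U \<subseteq> fvec.span B" "card B = fvec.dim U"
    using fvec.basis_exists by blast
  then obtain a b c where "B = {a, b, c}"
    using assms(2) by (auto simp: card_3_iff)
  with B assms show ?thesis
    by (intro that[of a b c]) (simp_all add: indep_iff plane_eq_span fvec.span_minimal subset_antisym)
qed

text \<open>Over two elements a line has a single nonzero vector. This trades dimensions of
  intersections for pairs of common points.\<close>

lemma dim_le_1_iff:
  assumes "fvec.subspace S" "S \<subseteq> coord_space n"
  shows "fvec.dim S \<le> 1 \<longleftrightarrow> (\<forall>u\<in>S. \<forall>w\<in>S. u \<noteq> 0 \<longrightarrow> w \<noteq> 0 \<longrightarrow> u = (w :: nat \<Rightarrow> bit))"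
proof
  obtain B where B: "B \<subseteq> S" "fvec.independent B" "S \<subseteq> fvec.span B" "card B = fvec.dim S"
    by (rule fvec.basis_exists)
  assume "fvec.dim S \<le> 1"
  moreover have "finite B"
    using B(1) assms(2) finite_coord_space by (blast intro: finite_subset)
  ultimately have "\<forall>a\<in>B. \<forall>b\<in>B. a = b"
    using B(4) card_le_Suc0_iff_eq[of B] by simp
  then have "\<exists>b. B \<subseteq> {b}" by blast
  then obtain b where "B \<subseteq> {b}" by blast
  with B(3) have "S \<subseteq> fvec.span {b}"
    using fvec.span_mono[of B "{b}"] by blast
  then have "S \<subseteq> {0, b}" by (simp add: fvec.span_singleton UNIV_bit)
  then show "\<forall>u\<in>S. \<forall>w\<in>S. u \<noteq> 0 \<longrightarrow> w \<noteq> 0 \<longrightarrow> u = w" by blast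
next
  assume *: "\<forall>u\<in>S. \<forall>w\<in>S. u \<noteq> 0 \<longrightarrow> w \<noteq> 0 \<longrightarrow> u = w"
  have "\<exists>u. S \<subseteq> {0, u}"
    using * by blast
  then obtain u where "S \<subseteq> {0, u}" by blast
  moreover have "{0, u} \<subseteq> fvec.span {u}"
    by (auto intro: fvec.span_zero fvec.span_base)
  ultimately have "S \<subseteq> fvec.span {u}" by blast
  from fvec.dim_le_card[OF this] show "fvec.dim S \<le> 1" by simp
qed

text \<open>The indexing lets codes be counted on product sets of parameters.\<close>

definition plane_packing :: "nat \<Rightarrow> 'i set \<Rightarrow> ('i \<Rightarrow> (nat \<Rightarrow> bit) set) \<Rightarrow> bool" where
  "plane_packing v I F \<longleftrightarrow>
     (\<forall>i\<in>I. fvec.subspace (F i) \<and> F i \<subseteq> coord_space v \<and> fvec.dim (F i) = 3) \<and>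
     (\<forall>i\<in>I. \<forall>j\<in>I. \<forall>u\<in>F i \<inter> F j. \<forall>w\<in>F i \<inter> F j. u \<noteq> 0 \<longrightarrow> w \<noteq> 0 \<longrightarrow> u \<noteq> w \<longrightarrow> i = j)"

text \<open>Planes \<open>U\<close> and \<open>W\<close> have distance
  \<open>6 - 2 * dim (U \<inter> W)\<close>, which is at least 4 exactly when they meet in dimension
  at most one.\<close>

lemma code_iff_plane_packing: "constant_dim_code v 4 3 C \<longleftrightarrow> plane_packing v C (\<lambda>U. U)"
proof -
  have dist_iff: "int 4 \<le> subspace_dist U W \<longleftrightarrow>
          (\<forall>u\<in>U \<inter> W. \<forall>w\<in>U \<inter> W. u \<noteq> 0 \<longrightarrow> w \<noteq> 0 \<longrightarrow> u = w)"
    if "fvec.subspace U \<and> U \<subseteq> coord_space v \<and> fvec.dim U = 3"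
       "fvec.subspace W \<and> W \<subseteq> coord_space v \<and> fvec.dim W = 3" for U W :: "(nat \<Rightarrow> bit) set"
  proof -
    have "int 4 \<le> subspace_dist U W \<longleftrightarrow> fvec.dim (U \<inter> W) \<le> 1"
      using that by (auto simp: subspace_dist_def)
    also have "\<dots> \<longleftrightarrow> (\<forall>u\<in>U \<inter> W. \<forall>w\<in>U \<inter> W. u \<noteq> 0 \<longrightarrow> w \<noteq> 0 \<longrightarrow> u = w)"
      using that by (intro dim_le_1_iff) (auto intro: fvec.subspace_inter)
    finally show ?thesis .
  qed
  show ?thesis
    unfolding constant_dim_code_def plane_packing_def
  proof (intro conj_cong ball_cong refl)
    fix U W
    assume C: "\<forall>U\<in>C. fvec.subspace U \<and> U \<subseteq> coord_space v \<and> fvec.dim U = 3" "U \<in> C" "W \<in> C"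
    have "int 4 \<le> subspace_dist U W \<longleftrightarrow>
            (\<forall>u\<in>U \<inter> W. \<forall>w\<in>U \<inter> W. u \<noteq> 0 \<longrightarrow> w \<noteq> 0 \<longrightarrow> u = w)"
      using C by (intro dist_iff) simp_all
    then show "(U \<noteq> W \<longrightarrow> int 4 \<le> subspace_dist U W) \<longleftrightarrow>
        (\<forall>u\<in>U \<inter> W. \<forall>w\<in>U \<inter> W. u \<noteq> 0 \<longrightarrow> w \<noteq> 0 \<longrightarrow> u \<noteq> w \<longrightarrow> U = W)"
      by blast
  qed
qed

text \<open>A plane has two distinct nonzero points, and equal members would share both.\<close>

lemma plane_packing_inj_on:
  assumes "plane_packing v I F"
  shows "inj_on F I"
proof (rule inj_onI)
  fix i j assume ij: "i \<in> I" "j \<in> I" "F i = F j"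
  then have "fvec.subspace (F i)" "F i \<subseteq> coord_space v" "\<not> fvec.dim (F i) \<le> 1"
    using assms by (auto simp: plane_packing_def)
  then obtain u w where "u \<in> F i" "w \<in> F i" "u \<noteq> 0" "w \<noteq> 0" "u \<noteq> w"
    using dim_le_1_iff[of "F i" v] by blast
  then show "i = j" using assms ij unfolding plane_packing_def by auto
qed

lemma card_le_max_code_size:
  assumes "plane_packing v I F"
  shows "card I \<le> max_code_size TYPE(bit) v 4 3"
proof -
  have "constant_dim_code v 4 3 (F ` I)"
    unfolding code_iff_plane_packing plane_packing_def
  proof (intro conjI ballI impI)
    fix U W u w
    assume "U \<in> F ` I" "W \<in> F ` I"
    then obtain i j where ij: "i \<in> I" "j \<in> I" "U = F i" "W = F j" by blast
    assume "u \<in> U \<inter> W" "w \<in> U \<inter> W" "u \<noteq> 0" "w \<noteq> 0" "u \<noteq> w"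
    with ij assms have "i = j" unfolding plane_packing_def by metis
    with ij show "U = W" by simp
  qed (use assms in \<open>auto simp: plane_packing_def\<close>)
  then have "card (F ` I) \<le> Max {card C | C :: (nat \<Rightarrow> bit) set set. constant_dim_code v 4 3 C}"
    using finite_constant_dim_codes[where 'f = bit] by (intro Max_ge) auto
  then show ?thesis
    by (simp add: max_code_size_def card_image[OF plane_packing_inj_on[OF assms]])
qed

lemma obtain_optimal_code:
  obtains C where "plane_packing v C (\<lambda>U. U)" "card C = max_code_size TYPE(bit) v 4 3"
proof -
  let ?A = "{card C | C :: (nat \<Rightarrow> bit) set set. constant_dim_code v 4 3 C}"
  have "finite ?A" "?A \<noteq> {}"
    using finite_constant_dim_codes[where 'f = bit] by (auto intro: constant_dim_code_empty)
  from Max_in[OF this] show ?thesis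
    using that by (auto simp: max_code_size_def code_iff_plane_packing)
qed

section \<open>The linkage construction\<close>

definition glue :: "nat \<Rightarrow> (nat \<Rightarrow> bit) \<Rightarrow> (nat \<Rightarrow> bit) \<Rightarrow> nat \<Rightarrow> bit" where
  "glue m a r i = (if i < m then a i else r (i - m))"

lemma glue_add: "glue m a r + glue m b s = glue m (a + b) (r + s)"
  and glue_scale: "vscale x (glue m a r) = glue m (vscale x a) (vscale x r)"
  by (auto simp: glue_def vscale_def fun_eq_iff)

lemma glue_eq_iff:
  assumes "a \<in> coord_space m" "b \<in> coord_space m"
  shows "glue m a r = glue m b s \<longleftrightarrow> a = b \<and> r = s"
proof (intro iffI conjI)
  assume eq: "glue m a r = glue m b s"
  show "a = b"
  proof
    fix i
    show "a i = b i"
      using fun_cong[OF eq, of i] assms by (cases "i < m") (auto simp: glue_def coord_space_def)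
  qed
  show "r = s"
  proof
    fix i
    show "r i = s i" using fun_cong[OF eq, of "i + m"] by (simp add: glue_def)
  qed
qed auto

lemma glue_0: "glue m 0 0 = 0"
  by (simp add: glue_def fun_eq_iff)

lemma glue_in_coord_space: "r \<in> coord_space n \<Longrightarrow> glue m a r \<in> coord_space (m + n)"
  by (auto simp: glue_def coord_space_def)

text \<open>
  For such \<open>T\<close> the matrices with rows \<open>r\<close>, \<open>s\<close>, \<open>T r + T (T s)\<close> form an additive code in which every
  nonzero member has rank at least two: the rows of one of rank one would be multiples \<open>p g\<close>, \<open>q g\<close>, \<open>r g\<close> of
  a single vector \<open>g\<close>, whence \<open>p T g + q T (T g) + r g = 0\<close>.
\<close>

definition quadratic_free :: "nat \<Rightarrow> ((nat \<Rightarrow> bit) \<Rightarrow> nat \<Rightarrow> bit) \<Rightarrow> bool" where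
  "quadratic_free n T \<longleftrightarrow>
     (\<forall>x y. T (x + y) = T x + T y) \<and> T ` coord_space n \<subseteq> coord_space n \<and>
     (\<forall>x\<in>coord_space n. \<forall>p q r. vscale p (T x) + vscale q (T (T x)) + vscale r x = 0 \<longrightarrow>
        x = 0 \<or> p = 0 \<and> q = 0 \<and> r = 0)"

text \<open>Distinct nonzero triples over two elements are linearly independent, so three vectors
  satisfying both relations span at most a line.\<close>

lemma rank_le_1_if_two_relations:
  fixes d e f :: "nat \<Rightarrow> bit"
  assumes "vscale x d + vscale y e + vscale z f = 0" "vscale x' d + vscale y' e + vscale z' f = 0"
    and "(x, y, z) \<noteq> (0, 0, 0)" "(x', y', z') \<noteq> (0, 0, 0)" "(x, y, z) \<noteq> (x', y', z')"
  shows "\<exists>g\<in>{d, e, f}. {d, e, f} \<subseteq> {0, g}"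
  using assms
  by (cases x; cases y; cases z; cases x'; cases y'; cases z') auto

lemma quadratic_free_relations:
  assumes T: "quadratic_free n T" and coord: "d \<in> coord_space n" "e \<in> coord_space n"
    and "vscale x d + vscale y e + vscale z (T d + T (T e)) = 0"
    and "vscale x' d + vscale y' e + vscale z' (T d + T (T e)) = 0"
    and "(x, y, z) \<noteq> (0, 0, 0)" "(x', y', z') \<noteq> (0, 0, 0)" "(x, y, z) \<noteq> (x', y', z')"
  shows "d = 0 \<and> e = 0"
proof -
  define f where "f = T d + T (T e)"
  have add: "T (u + w) = T u + T w" for u w
    using T by (simp add: quadratic_free_def)
  have T0: "T 0 = 0" using add[of 0 0] by simp
  have Tcoord: "T u \<in> coord_space n" if "u \<in> coord_space n" for u
    using T that by (auto simp: quadratic_free_def)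
  have "f \<in> coord_space n"
    unfolding f_def by (intro fvec.subspace_add subspace_coord_space Tcoord coord)
  moreover obtain g where g: "g \<in> {d, e, f}" "{d, e, f} \<subseteq> {0, g}"
    using rank_le_1_if_two_relations[OF assms(4-8)] unfolding f_def by blast
  ultimately have gc: "g \<in> coord_space n" using coord by auto
  have ex: "\<exists>p. u = vscale p g" if "u \<in> {d, e, f}" for u
  proof -
    have "u = 0 \<or> u = g" using g(2) that by blast
    then show ?thesis using vscale_bit[of g] by metis
  qed
  from ex[of d] ex[of e] ex[of f]
  obtain p q r where pqr: "d = vscale p g" "e = vscale q g" "f = vscale r g"
    by auto
  have Tscale: "T (vscale p u) = vscale p (T u)" for p u
    by (cases p) (simp_all add: T0)
  \<comment> \<open>This is \<open>f + f = 0\<close> with one copy of \<open>f\<close> expanded as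
    \<open>T d + T (T e)\<close>.\<close>
  have "vscale p (T g) + vscale q (T (T g)) + vscale r g = 0"
    using f_def unfolding pqr Tscale by (metis add_self_bit_vector)
  then have "g = 0 \<or> p = 0 \<and> q = 0 \<and> r = 0"
    using T gc unfolding quadratic_free_def by blast
  then show ?thesis unfolding pqr by auto
qed

text \<open>Two common points of two glued planes project to distinct nonzero common points of the
  underlying codewords, which therefore coincide. The coordinates of the two points are then
  independent relations between the rows of the difference of the two matrices, so this difference
  vanishes.\<close>

lemma linkage:
  assumes C: "plane_packing m C (\<lambda>U. U)" and T: "quadratic_free n T"
  shows "card C * 4 ^ n \<le> max_code_size TYPE(bit) (m + n) 4 3"
proof -
  have "\<exists>a b c. indep a b c \<and> U = plane a b c" if "U \<in> C" for U
    using C that by (metis obtain_plane plane_packing_def)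
  then obtain a b c where ind: "\<And>U. U \<in> C \<Longrightarrow> indep (a U) (b U) (c U)"
    and U_eq: "\<And>U. U \<in> C \<Longrightarrow> U = plane (a U) (b U) (c U)"
    by metis
  define K :: "(nat \<Rightarrow> bit) set" where "K = coord_space n"
  define h where "h r s = T r + T (T s)" for r s
  define comb where "comb x y z u v w = vscale x u + vscale y v + vscale z w"
    for x y z :: bit and u v w :: "nat \<Rightarrow> bit"
  define F where "F = (\<lambda>(U, r, s). plane (glue m (a U) r) (glue m (b U) s) (glue m (c U) (h r s)))"
  have T_add: "T (u + w) = T u + T w" for u w
    using T by (simp add: quadratic_free_def)
  have T_coord: "T u \<in> coord_space n" if "u \<in> coord_space n" for u
    using T that by (auto simp: quadratic_free_def)
  have h_add: "h (r + r') (s + s') = h r s + h r' s'" for r r' s s'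
    by (simp add: h_def T_add algebra_simps)
  have h_K: "h r s \<in> K" if "r \<in> K" "s \<in> K" for r s
    using that T_coord unfolding h_def K_def
    by (intro fvec.subspace_add subspace_coord_space) blast+
  have comb_glue: "comb x y z (glue m u r) (glue m v s) (glue m w t) =
      glue m (comb x y z u v w) (comb x y z r s t)" for x y z u v w r s t
    by (simp add: comb_def glue_add glue_scale)
  have comb_in: "comb x y z (a U) (b U) (c U) \<in> U" if "U \<in> C" for x y z U
    using U_eq[OF that] by (auto simp: comb_def plane_def)
  have C_coord: "U \<subseteq> coord_space m" if "U \<in> C" for U
    using C that by (simp add: plane_packing_def)
  have comb_coord: "comb x y z (a U) (b U) (c U) \<in> coord_space m" if "U \<in> C" for x y z U
    using comb_in[OF that] C_coord[OF that] by blast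
  have abc_coord: "a U \<in> coord_space m" "b U \<in> coord_space m" "c U \<in> coord_space m" if "U \<in> C" for U
    using comb_coord[OF that, of 1 0 0] comb_coord[OF that, of 0 1 0] comb_coord[OF that, of 0 0 1]
    by (simp_all add: comb_def)
  have comb_0: "x = 0 \<and> y = 0 \<and> z = 0" if "comb x y z (a U) (b U) (c U) = 0" "U \<in> C" for x y z U
    using ind that by (auto simp: indep_def comb_def)
  have comb_add: "comb x y z u v w + comb x' y' z' u v w = comb (x + x') (y + y') (z + z') u v w"
    for x y z x' y' z' u v w
    by (simp only: comb_def fvec.scale_left_distrib ac_simps)
  have comb_add': "comb x y z u v w + comb x y z u' v' w' = comb x y z (u + u') (v + v') (w + w')"
    for x y z u v w u' v' w'
    by (simp only: comb_def fvec.scale_right_distrib ac_simps)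
  have comb_inj: "x = x' \<and> y = y' \<and> z = z'"
    if "comb x y z (a U) (b U) (c U) = comb x' y' z' (a U) (b U) (c U)" "U \<in> C" for x y z x' y' z' U
  proof -
    have "comb (x + x') (y + y') (z + z') (a U) (b U) (c U) = 0"
      unfolding comb_add[symmetric] that(1) by (rule add_self_bit_vector)
    from comb_0[OF this that(2)] have "x + x' = 0 \<and> y + y' = 0 \<and> z + z' = 0" .
    then show ?thesis
      by (cases x; cases y; cases z; cases x'; cases y'; cases z') simp_all
  qed
  have in_F: "\<exists>x y z. u = glue m (comb x y z (a U) (b U) (c U)) (comb x y z r s (h r s))"
    if "u \<in> F (U, r, s)" for u U r s
    using that by (auto simp: F_def plane_def simp flip: comb_def comb_glue)
  have "plane_packing (m + n) (C \<times> K \<times> K) F"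
    unfolding plane_packing_def
  proof (intro conjI ballI impI; (elim SigmaE)?)
    fix i U t r s
    assume i: "i = (U, t)" "t = (r, s)" and *: "U \<in> C" "r \<in> K" "s \<in> K"
    show "fvec.subspace (F i)"
      by (simp add: i F_def subspace_plane)
    show "F i \<subseteq> coord_space (m + n)"
      unfolding i F_def prod.case using * h_K
      by (intro plane_subset subspace_coord_space glue_in_coord_space) (auto simp: K_def)
    have "indep (glue m (a U) r) (glue m (b U) s) (glue m (c U) (h r s))"
      unfolding indep_def
    proof (intro allI impI)
      fix x y z
      assume "vscale x (glue m (a U) r) + vscale y (glue m (b U) s) + vscale z (glue m (c U) (h r s)) = 0"
      then have "glue m (comb x y z (a U) (b U) (c U)) (comb x y z r s (h r s)) = glue m 0 0"
        by (simp add: glue_0 flip: comb_def comb_glue)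
      then have "comb x y z (a U) (b U) (c U) = 0"
        using comb_coord * by (subst (asm) glue_eq_iff) (auto simp: coord_space_def)
      then show "x = 0 \<and> y = 0 \<and> z = 0" using comb_0 * by blast
    qed
    then show "fvec.dim (F i) = 3"
      unfolding i F_def prod.case by (rule dim_plane)
  next
    fix i j u w U t r s U' t' r' s'
    assume ij: "i = (U, t)" "t = (r, s)" "j = (U', t')" "t' = (r', s')"
      and *: "U \<in> C" "r \<in> K" "s \<in> K" "U' \<in> C" "r' \<in> K" "s' \<in> K"
      and u: "u \<in> F i \<inter> F j" and w: "w \<in> F i \<inter> F j" and uw: "u \<noteq> 0" "w \<noteq> 0" "u \<noteq> w"
    \<comment> \<open>Stated for an arbitrary common point, to be applied to both \<open>u\<close>
      and \<open>w\<close>; \<open>(x, y, z)\<close> are its coordinates in the basis chosen for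
      \<open>U\<close>.\<close>
    have *: "\<exists>x y z. u = glue m (comb x y z (a U) (b U) (c U)) (comb x y z r s (h r s)) \<and>
        comb x y z (a U) (b U) (c U) \<in> U \<inter> U' \<and> (x, y, z) \<noteq> (0, 0, 0) \<and>
        (U = U' \<longrightarrow> comb x y z (r + r') (s + s') (h (r + r') (s + s')) = 0)"
      if u: "u \<in> F i \<inter> F j" and "u \<noteq> 0" for u
    proof -
      obtain x y z where 1: "u = glue m (comb x y z (a U) (b U) (c U)) (comb x y z r s (h r s))"
        using u in_F[of u U r s] by (auto simp: ij)
      obtain x' y' z' where 2: "u = glue m (comb x' y' z' (a U') (b U') (c U')) (comb x' y' z' r' s' (h r' s'))"
        using u in_F[of u U' r' s'] by (auto simp: ij)
      have 3: "comb x y z (a U) (b U) (c U) = comb x' y' z' (a U') (b U') (c U')"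
        and 4: "comb x y z r s (h r s) = comb x' y' z' r' s' (h r' s')"
        using 1 2 comb_coord * glue_eq_iff by (metis (no_types))+
      have "(x, y, z) \<noteq> (0, 0, 0)"
        using 1 \<open>u \<noteq> 0\<close> glue_0 by (auto simp: comb_def)
      moreover have "comb x y z (a U) (b U) (c U) \<in> U \<inter> U'"
        using comb_in[OF \<open>U \<in> C\<close>, of x y z] comb_in[OF \<open>U' \<in> C\<close>, of x' y' z'] 3 by simp
      moreover have "comb x y z (r + r') (s + s') (h (r + r') (s + s')) = 0" if "U = U'"
      proof -
        \<comment> \<open>Equal codewords carry the same basis, so the coordinates agree, and
          additivity of \<open>h\<close> turns the equality of the right halves into a relation for
          the difference.\<close>
        have "x = x' \<and> y = y' \<and> z = z'"
          using comb_inj[of x y z U x' y' z'] 3 that \<open>U \<in> C\<close> by simp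
        then show ?thesis
          using 4 by (simp only: h_add comb_add'[symmetric] add_self_bit_vector)
      qed
      ultimately show ?thesis using 1 by blast
    qed
    from *[OF u uw(1)] obtain x y z where
      1: "u = glue m (comb x y z (a U) (b U) (c U)) (comb x y z r s (h r s))"
        "comb x y z (a U) (b U) (c U) \<in> U \<inter> U'" "(x, y, z) \<noteq> (0, 0, 0)"
        "U = U' \<longrightarrow> comb x y z (r + r') (s + s') (h (r + r') (s + s')) = 0" by blast
    from *[OF w uw(2)] obtain x' y' z' where
      2: "w = glue m (comb x' y' z' (a U) (b U) (c U)) (comb x' y' z' r s (h r s))"
        "comb x' y' z' (a U) (b U) (c U) \<in> U \<inter> U'" "(x', y', z') \<noteq> (0, 0, 0)"
        "U = U' \<longrightarrow> comb x' y' z' (r + r') (s + s') (h (r + r') (s + s')) = 0" by blast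
    have neq: "(x, y, z) \<noteq> (x', y', z')" using 1 2 uw by auto
    have "comb x y z (a U) (b U) (c U) \<noteq> comb x' y' z' (a U) (b U) (c U)"
      using neq comb_inj \<open>U \<in> C\<close> by blast
    moreover have "comb x y z (a U) (b U) (c U) \<noteq> 0" "comb x' y' z' (a U) (b U) (c U) \<noteq> 0"
      using 1 2 comb_0 \<open>U \<in> C\<close> by blast+
    ultimately have [simp]: "U' = U"
      using C 1(2) 2(2) \<open>U \<in> C\<close> \<open>U' \<in> C\<close> unfolding plane_packing_def by metis
    have "r + r' \<in> K" "s + s' \<in> K"
      using \<open>r \<in> K\<close> \<open>r' \<in> K\<close> \<open>s \<in> K\<close> \<open>s' \<in> K\<close> unfolding K_def
      by (auto intro: fvec.subspace_add subspace_coord_space)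
    from quadratic_free_relations[OF T this[unfolded K_def], of x y z x' y' z']
    have "r + r' = 0 \<and> s + s' = 0"
      using 1 2 neq by (simp add: comb_def h_def)
    then show "i = j" by (simp add: ij)
  qed
  from card_le_max_code_size[OF this] show ?thesis
    by (simp add: K_def card_cartesian_product card_coord_space mult.assoc flip: power_mult_distrib)
qed

section \<open>Shift registers\<close>

text \<open>For \<open>S\<close> below \<open>n\<close>, the companion map of the polynomial
  \<open>x^n\<close> plus the sum of \<open>x^j\<close> over \<open>j \<in> S\<close>.\<close>

definition shift_register :: "nat \<Rightarrow> nat set \<Rightarrow> (nat \<Rightarrow> bit) \<Rightarrow> nat \<Rightarrow> bit" where
  "shift_register n S x i =
     (if Suc i < n then x (Suc i) else if Suc i = n then (\<Sum>j\<in>S. x j) else 0)"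

lemma shift_register_add:
  "shift_register n S (x + y) = shift_register n S x + shift_register n S y"
proof
  fix i
  show "shift_register n S (x + y) i = (shift_register n S x + shift_register n S y) i"
    using sum.distrib[of x y S] unfolding shift_register_def plus_fun_apply
    by (cases "Suc i < n"; cases "Suc i = n") (simp_all only: if_True if_False refl simp_thms add_0_right)
qed

lemma shift_register_in_coord_space: "shift_register n S x \<in> coord_space n"
  by (auto simp: shift_register_def coord_space_def)

lemma coord_space_eq_0_iff: "x \<in> coord_space n \<Longrightarrow> x = 0 \<longleftrightarrow> (\<forall>i<n. x i = 0)"
  by (auto simp: coord_space_def fun_eq_iff) (metis not_le)

lemma quadratic_free_shift_registerI:
  assumes "\<And>x p q r. (\<And>i. p * shift_register n S x i +
      q * shift_register n S (shift_register n S x) i + r * x i = 0) \<Longrightarrow>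
      (\<forall>i<n. x i = 0) \<or> p = 0 \<and> q = 0 \<and> r = 0"
  shows "quadratic_free n (shift_register n S)"
  unfolding quadratic_free_def
proof (intro conjI allI ballI impI)
  let ?T = "shift_register n S"
  fix x :: "nat \<Rightarrow> bit" and p q r
  assume x: "x \<in> coord_space n" and eq: "vscale p (?T x) + vscale q (?T (?T x)) + vscale r x = 0"
  have "p * ?T x i + q * ?T (?T x) i + r * x i = 0" for i
    using fun_cong[OF eq, of i] by (simp only: vscale_def plus_fun_apply zero_fun_apply)
  from assms[OF this] show "x = 0 \<or> p = 0 \<and> q = 0 \<and> r = 0"
    using x coord_space_eq_0_iff by blast
qed (auto simp: shift_register_add shift_register_in_coord_space)

text \<open>The characteristic polynomial \<open>x^3 + x + 1\<close> is irreducible, so no nonzero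
  polynomial of degree at most two in the map kills a nonzero vector; the proof checks this on all
  bits. Lengths 4 and 5 use \<open>x^4 + x + 1\<close> and \<open>x^5 + x^2 + 1\<close> in the same
  way.\<close>

lemma quadratic_free_3: "quadratic_free 3 (shift_register 3 {0, 1})"
proof (rule quadratic_free_shift_registerI)
  fix x :: "nat \<Rightarrow> bit" and p q r
  let ?T = "shift_register 3 {0, 1}"
  have T: "?T y 0 = y 1" "?T y 1 = y 2" "?T y 2 = y 0 + y 1" for y
    by (simp_all add: shift_register_def numeral_eq_Suc)
  assume "\<And>i. p * ?T x i + q * ?T (?T x) i + r * x i = 0"
  from this[of 0] this[of 1] this[of 2]
  have "(x 0 = 0 \<and> x 1 = 0 \<and> x 2 = 0) \<or> p = 0 \<and> q = 0 \<and> r = 0"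
    unfolding T by (cases p; cases q; cases r; cases "x 0"; cases "x 1"; cases "x 2") simp_all
  then show "(\<forall>i<3. x i = 0) \<or> p = 0 \<and> q = 0 \<and> r = 0"
    by (auto simp: less_Suc_eq numeral_eq_Suc)
qed

lemma quadratic_free_4: "quadratic_free 4 (shift_register 4 {0, 1})"
proof (rule quadratic_free_shift_registerI)
  fix x :: "nat \<Rightarrow> bit" and p q r
  let ?T = "shift_register 4 {0, 1}"
  have T: "?T y 0 = y 1" "?T y 1 = y 2" "?T y 2 = y 3" "?T y 3 = y 0 + y 1" for y
    by (simp_all add: shift_register_def numeral_eq_Suc)
  assume "\<And>i. p * ?T x i + q * ?T (?T x) i + r * x i = 0"
  from this[of 0] this[of 1] this[of 2] this[of 3]
  have "(x 0 = 0 \<and> x 1 = 0 \<and> x 2 = 0 \<and> x 3 = 0) \<or> p = 0 \<and> q = 0 \<and> r = 0"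
    unfolding T
    by (cases p; cases q; cases r; cases "x 0"; cases "x 1"; cases "x 2"; cases "x 3") simp_all
  then show "(\<forall>i<4. x i = 0) \<or> p = 0 \<and> q = 0 \<and> r = 0"
    by (auto simp: less_Suc_eq numeral_eq_Suc)
qed

lemma quadratic_free_5: "quadratic_free 5 (shift_register 5 {0, 2})"
proof (rule quadratic_free_shift_registerI)
  fix x :: "nat \<Rightarrow> bit" and p q r
  let ?T = "shift_register 5 {0, 2}"
  have T: "?T y 0 = y 1" "?T y 1 = y 2" "?T y 2 = y 3" "?T y 3 = y 4" "?T y 4 = y 0 + y 2" for y
    by (simp_all add: shift_register_def numeral_eq_Suc)
  assume "\<And>i. p * ?T x i + q * ?T (?T x) i + r * x i = 0"
  from this[of 0] this[of 1] this[of 2] this[of 3] this[of 4]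
  have "(x 0 = 0 \<and> x 1 = 0 \<and> x 2 = 0 \<and> x 3 = 0 \<and> x 4 = 0) \<or> p = 0 \<and> q = 0 \<and> r = 0"
    unfolding T
    by (cases p; cases q; cases r; cases "x 0"; cases "x 1"; cases "x 2"; cases "x 3"; cases "x 4")
       simp_all
  then show "(\<forall>i<5. x i = 0) \<or> p = 0 \<and> q = 0 \<and> r = 0"
    by (auto simp: less_Suc_eq numeral_eq_Suc)
qed

section \<open>The field of order 2^13 through the powers of a generator\<close>

definition bitvec :: "bit list \<Rightarrow> nat \<Rightarrow> bit" where
  "bitvec bs i = (if i < length bs then bs ! i else 0)"

text \<open>
  The characteristic polynomial of the map is the primitive polynomial \<open>x\<^sup>1\<^sup>3 + x\<^sup>1\<^sup>2 + x\<^sup>1\<^sup>0 + x\<^sup>9 + 1\<close>, so the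
  vector \<open>singer n\<close> plays the role of the power \<open>\<alpha>\<^sup>n\<close> of a generator of the field of order \<open>2\<^sup>1\<^sup>3\<close>.
\<close>

definition singer_map :: "(nat \<Rightarrow> bit) \<Rightarrow> nat \<Rightarrow> bit" where
  "singer_map = shift_register 13 {0, 9, 10, 12}"

definition singer :: "nat \<Rightarrow> nat \<Rightarrow> bit" where
  "singer n = (singer_map ^^ n) (bitvec [1, 0, 0, 0, 0, 0, 0, 0, 0, 0, 0, 0, 0])"

lemma singer_map_bitvec:
  "singer_map (bitvec [b0,b1,b2,b3,b4,b5,b6,b7,b8,b9,b10,b11,b12]) =
   bitvec [b1,b2,b3,b4,b5,b6,b7,b8,b9,b10,b11,b12,b0 + b9 + b10 + b12]"
  by (auto simp: singer_map_def fun_eq_iff bitvec_def shift_register_def less_Suc_eq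
      numeral_eq_Suc add.assoc)

lemma bitvec_add:
  "bitvec [b0,b1,b2,b3,b4,b5,b6,b7,b8,b9,b10,b11,b12] +
   bitvec [c0,c1,c2,c3,c4,c5,c6,c7,c8,c9,c10,c11,c12] =
   bitvec [b0+c0,b1+c1,b2+c2,b3+c3,b4+c4,b5+c5,b6+c6,b7+c7,b8+c8,b9+c9,b10+c10,b11+c11,b12+c12]"
  by (auto simp: fun_eq_iff bitvec_def less_Suc_eq)

text \<open>Splitting the exponent along its binary digits keeps it out of unary form while the
  register is run.\<close>

lemma funpow_double:
  "(f ^^ numeral num.One) x = f x"
  "(f ^^ numeral (num.Bit0 n)) x = (f ^^ numeral n) ((f ^^ numeral n) x)"
  "(f ^^ numeral (num.Bit1 n)) x = (f ^^ numeral n) ((f ^^ numeral n) (f x))"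
  by (simp_all only: numeral.simps funpow_add o_apply funpow.simps id_apply One_nat_def)

lemma bit_add_table: "0 + 0 = (0::bit)" "0 + 1 = (1::bit)" "1 + 0 = (1::bit)" "1 + 1 = (0::bit)"
  by simp_all

lemmas singer_eval = singer_def funpow_double funpow_0 singer_map_bitvec bit_add_table

lemma singer_in_coord_space: "singer n \<in> coord_space 13"
  by (cases n)
     (auto simp: singer_def singer_map_def shift_register_in_coord_space, simp add: coord_space_def bitvec_def)

lemma funpow_singer_map: "(singer_map ^^ m) (singer n) = singer (m + n)"
  by (simp add: singer_def funpow_add)

lemma funpow_singer_map_add:
  "(singer_map ^^ m) (x + y) = (singer_map ^^ m) x + (singer_map ^^ m) y"
  by (induction m) (simp_all only: funpow.simps o_apply id_apply singer_map_def shift_register_add)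

lemma singer_8191: "singer 8191 = singer 0"
  by (simp only: singer_eval)

lemma singer_1_neq: "singer 1 \<noteq> singer 0"
proof -
  have "singer 1 = bitvec [0, 0, 0, 0, 0, 0, 0, 0, 0, 0, 0, 0, 1]"
    by (simp only: singer_eval One_nat_def funpow.simps o_apply id_apply)
  then have "singer 1 0 \<noteq> singer 0 0"
    by (simp add: singer_def bitvec_def)
  then show ?thesis by metis
qed

lemma singer_periodic: "singer (n + 8191 * k) = singer n"
proof (induction k)
  case (Suc k)
  have "singer (n + 8191 * Suc k) = (singer_map ^^ (n + 8191 * k)) (singer 8191)"
    by (simp add: funpow_singer_map algebra_simps)
  then show ?case using Suc by (simp add: singer_8191 funpow_singer_map)
qed simp

lemma singer_neq_0: "singer n \<noteq> 0"
proof
  assume "singer n = 0"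
  moreover have "(singer_map ^^ m) 0 = 0" for m
    using funpow_singer_map_add[of m 0 0] by simp
  ultimately have "singer (m + n) = 0" for m
    by (metis funpow_singer_map)
  \<comment> \<open>The exponent becomes \<open>8191 * n\<close>, a multiple of the period.\<close>
  from this[of "8190 * n"] have "singer 0 = 0"
    using singer_periodic[of 0 n] by (simp add: algebra_simps)
  then show False by (auto simp: singer_def bitvec_def dest: fun_cong[where x = 0])
qed

lemma prime_8191: "prime (8191 :: nat)"
proof -
  have "\<not> p dvd 8191" if "prime p" "p\<^sup>2 \<le> 8191" for p :: nat
  proof -
    \<comment> \<open>Trial division can stop at 90, as 91^2 = 8281.\<close>
    have "p < 91"
    proof (rule ccontr)
      assume "\<not> p < 91"
      with that(2) power_mono[of 91 p 2] show False by simp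
    qed
    then have "p \<in> set [2..<91]"
      using prime_ge_2_nat[OF that(1)] by (simp only: set_upt atLeastLessThan_iff)
    moreover have "\<forall>p\<in>set [2..<91]. \<not> p dvd (8191 :: nat)"
      by (simp add: upt_rec)
    ultimately show ?thesis by blast
  qed
  then show ?thesis
    by (subst prime_prime_factor_sqrt) auto
qed

text \<open>The period 8191 is prime. A period coprime to it would, by Bezout, make 1 a period as
  well.\<close>

lemma singer_eq_imp_cong:
  assumes "singer a = singer b"
  shows "[a = b] (mod 8191)"
proof -
  have *: "8191 dvd d" if "singer (a + d) = singer a" for a d
  proof (rule ccontr)
    assume "\<not> 8191 dvd d"
    then have "coprime d 8191"
      using prime_imp_coprime[OF prime_8191] by (simp add: coprime_commute)
    \<comment> \<open>Adding \<open>8190 * a\<close> moves the base point \<open>a\<close> to a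
      multiple of 8191.\<close>
    have "singer (8190 * a + (a + d)) = singer (8190 * a + a)"
      using that by (metis funpow_singer_map)
    then have "singer d = singer 0"
      using singer_periodic[of d a] singer_periodic[of 0 a] by (simp add: algebra_simps)
    have "singer (d * k) = singer 0" for k
      by (induction k) (use \<open>singer d = singer 0\<close> funpow_singer_map in \<open>metis add.right_neutral mult_0_right mult_Suc_right add.commute\<close>)+
    moreover obtain x y where "d * x = 8191 * y + 1"
      using coprime_bezout_strong[of d 8191] \<open>coprime d 8191\<close> by auto
    ultimately show False
      using singer_periodic[of 1 y] singer_1_neq by (metis add.commute)
  qed
  show ?thesis
  proof (cases a b rule: le_cases)
    case le
    then show ?thesis using *[of a "b - a"] assms
      by (metis cong_altdef_nat cong_sym le_add_diff_inverse)
  next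
    case ge
    then show ?thesis using *[of b "a - b"] assms
      by (metis cong_altdef_nat le_add_diff_inverse)
  qed
qed

text \<open>
  The Frobenius map without field multiplication: the operator \<open>A = \<alpha>\<^sup>a + \<alpha>\<^sup>b + \<alpha>\<^sup>c\<close> kills \<open>\<alpha>\<^sup>0\<close>, hence so
  does \<open>A\<^sup>2\<close>, in which the mixed terms cancel.
\<close>

lemma singer_add_double:
  assumes "singer a + singer b = singer c"
  shows "singer (2 * a) + singer (2 * b) = singer (2 * c)"
proof -
  let ?A = "\<lambda>m. singer (m + a) + singer (m + b) + singer (m + c)"
  have A: "?A m = 0" for m
    using funpow_singer_map_add[of m "singer a" "singer b"] assms by (simp add: funpow_singer_map)
  let ?s = "\<lambda>x y. singer (x + y)"
  have "?A a + ?A b + ?A c = (?s a a + ?s b b + ?s c c) +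
      (?s a b + ?s a b) + (?s a c + ?s a c) + (?s b c + ?s b c)"
    by (simp only: ac_simps)
  then have "?s a a + ?s b b + ?s c c = 0"
    unfolding A add_self_bit_vector by (simp only: add_0_right)
  then show ?thesis by (simp only: add_eq_0_bit_vector mult_2)
qed

text \<open>Doubling the exponents \<open>t\<close> times applies the \<open>t\<close>-th Frobenius
  power; \<open>n\<close> further steps of the register multiply by
  \<open>\<alpha>^n\<close>.\<close>

lemma singer_add_frobenius:
  assumes "singer a + singer b = singer c"
  shows "singer (n + 2 ^ t * a) + singer (n + 2 ^ t * b) = singer (n + 2 ^ t * c)"
proof -
  have "singer (2 ^ t * a) + singer (2 ^ t * b) = singer (2 ^ t * c)"
  proof (induction t)
    case 0
    show ?case using assms by (simp only: power_0 mult_1)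
  next
    case (Suc t)
    from singer_add_double[OF this] show ?case by (simp only: power_Suc mult.assoc)
  qed
  from arg_cong[OF this, of "singer_map ^^ n"] show ?thesis
    by (simp only: funpow_singer_map_add funpow_singer_map)
qed

section \<open>Seven-point lists and the fifteen base planes\<close>

definition fano :: "(nat \<Rightarrow> bit) list \<Rightarrow> bool" where
  "fano vs \<longleftrightarrow> (\<exists>a b c. vs = [a, b, a + b, c, a + c, b + c, a + b + c])"

text \<open>The entry at position \<open>i\<close>, counted from one, has the binary digits of
  \<open>i\<close> as coefficients, so \<open>a\<close>, \<open>b\<close>, \<open>c\<close> stand at
  positions 1, 2, 4 and four sums settle the rest.\<close>

lemma fano_list_iff:
  "fano [a, b, d, c, e, f, g] \<longleftrightarrow> a + b = d \<and> a + c = e \<and> b + c = f \<and> d + c = g"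
  by (auto simp: fano_def)

text \<open>Only relations of the form \<open>a + b = c\<close> between entries matter, so
  multiplication and Frobenius carry base planes to planes.\<close>

lemma fano_map:
  assumes "fano (map s xs)" and "\<And>a b c. s a + s b = s c \<Longrightarrow> s' a + s' b = s' c"
  shows "fano (map s' xs)"
proof -
  obtain l0 l1 l2 l3 l4 l5 l6 where "xs = [l0, l1, l2, l3, l4, l5, l6]"
    using assms(1) by (auto simp: fano_def map_eq_Cons_conv)
  then show ?thesis using assms by (simp only: list.map fano_list_iff)
qed

text \<open>Every nontrivial combination of \<open>a\<close>, \<open>b\<close>, \<open>c\<close> is
  an entry of the list, so the absence of 0 is independence.\<close>

lemma fano_plane:
  assumes "fano vs" "0 \<notin> set vs"
  shows "\<exists>a b c. indep a b c \<and> insert 0 (set vs) = plane a b c"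
proof -
  obtain a b c where vs: "vs = [a, b, a + b, c, a + c, b + c, a + b + c]"
    using assms(1) by (auto simp: fano_def)
  have "indep a b c"
    unfolding indep_def
  proof (intro allI impI)
    fix x y z assume "vscale x a + vscale y b + vscale z c = 0"
    with assms(2) show "x = 0 \<and> y = 0 \<and> z = 0"
      unfolding vs by (cases x; cases y; cases z) auto
  qed
  moreover have "w \<in> insert 0 (set vs) \<longleftrightarrow> w \<in> plane a b c" for w
  proof -
    have ex: "(\<exists>x. P x) \<longleftrightarrow> P 0 \<or> P 1" for P :: "bit \<Rightarrow> bool"
      by (metis bit.exhaust)
    show ?thesis
      by (simp add: plane_def ex vs) blast
  qed
  ultimately show ?thesis by blast
qed

text \<open>
  Logarithms of the nonzero points of the base planes found by Braun et al., moved by a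
  multiplication and a Frobenius power to keep the logarithms small, and listed in the order
  required by \<open>fano\<close>.
\<close>

definition steiner_planes :: "nat list list" where
  "steiner_planes =
   [[0, 171, 1803, 262, 1635, 1185, 2679],
    [0, 729, 2740, 871, 2369, 1371, 2250],
    [0, 95, 1146, 215, 546, 2823, 659],
    [0, 458, 762, 574, 2187, 2901, 736],
    [0, 630, 3045, 1024, 2955, 1180, 2037],
    [0, 65, 2233, 661, 1184, 3058, 1448],
    [0, 230, 2544, 887, 1898, 3160, 1555],
    [0, 276, 3015, 779, 3274, 2394, 1355],
    [0, 578, 700, 1227, 3367, 1517, 1510],
    [0, 1072, 2054, 1173, 2473, 1208, 3400],
    [0, 676, 3030, 793, 3829, 3853, 1377],
    [0, 1443, 1796, 1557, 3117, 3906, 1756],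
    [0, 62, 2486, 677, 1628, 4317, 2322],
    [0, 1085, 3248, 1970, 4727, 4309, 4331],
    [0, 1901, 2963, 2086, 3360, 2518, 4744]]"

lemma fano_steiner_planes: "\<forall>xs\<in>set steiner_planes. fano (map singer xs)"
  by (simp only: steiner_planes_def list.set ball_simps list.map singer_eval bitvec_add
      fano_list_iff simp_thms)

section \<open>The Steiner system in dimension 13\<close>

text \<open>
  Modulo the prime \<open>8191\<close> the conjugates of an exponent form a coset of the group generated by \<open>2\<close>,
  which has order \<open>13\<close>. The thirteenth power is constant on these cosets, and it separates the
  \<open>630\<close> differences of logarithms that occur. It is computed by folding at bit \<open>13\<close>, as
  \<open>2\<^sup>1\<^sup>3\<close> is congruent to \<open>1\<close>.
\<close>

definition mersenne_fold :: "nat \<Rightarrow> nat" where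
  "mersenne_fold x = take_bit 13 x + drop_bit 13 x"

text \<open>One fold of a product of two 13-bit numbers may leave 14 bits; the second brings it down
  to 13.\<close>

definition mersenne_mult :: "nat \<Rightarrow> nat \<Rightarrow> nat" where
  "mersenne_mult x y = mersenne_fold (mersenne_fold (x * y))"

definition mersenne_square :: "nat \<Rightarrow> nat" where
  "mersenne_square x = mersenne_mult x x"

text \<open>The thirteenth power as \<open>x * (x^3)^4\<close>, with five multiplications.\<close>

definition coset_key :: "nat \<Rightarrow> nat" where
  "coset_key x =
     mersenne_mult x (mersenne_square (mersenne_square (mersenne_mult x (mersenne_square x))))"

definition point_pairs :: "(nat list \<times> nat \<times> nat) list" where
  "point_pairs = [(xs, x, y). xs \<leftarrow> steiner_planes, x \<leftarrow> xs, y \<leftarrow> xs, x \<noteq> y]"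

text \<open>Multiplication by \<open>8190\<close> is negation modulo \<open>8191\<close>.\<close>

definition pair_key :: "nat list \<times> nat \<times> nat \<Rightarrow> nat" where
  "pair_key = (\<lambda>(xs, x, y). coset_key (mersenne_fold (mersenne_fold (x + 8190 * y))))"

text \<open>
  The simplifier revisits the branches of an \<open>if\<close>; dispatching on the Boolean by pattern keeps
  the sorting of the keys fast.
\<close>

definition insort_branch :: "bool \<Rightarrow> 'a::linorder \<Rightarrow> 'a \<Rightarrow> 'a list \<Rightarrow> 'a list" where
  "insort_branch b x y ys = (if b then x # y # ys else y # insort x ys)"

lemma insort_eval:
  "insort x [] = [x]"
  "insort x (y # ys) = insort_branch (x \<le> y) x y ys"
  "insort_branch True x y ys = x # y # ys"
  "insort_branch False x y ys = y # insort x ys"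
  by (simp_all add: insort_branch_def)

lemma mersenne_fold_cong: "[mersenne_fold x = x] (mod 8191)"
proof -
  have "x = mersenne_fold x + 8191 * (x div 8192)"
    by (simp add: mersenne_fold_def take_bit_eq_mod drop_bit_eq_div)
  then show ?thesis by (metis cong_def mod_mult_self2)
qed

lemma mersenne_mult_cong:
  assumes "[x = x'] (mod 8191)" "[y = y'] (mod 8191)"
  shows "[mersenne_mult x y = x' * y'] (mod 8191)"
  unfolding mersenne_mult_def
  by (meson assms cong_mult cong_trans mersenne_fold_cong)

lemma coset_key_cong: "[coset_key x = x ^ 13] (mod 8191)"
proof -
  have "[coset_key x = x * (((x * (x * x)) * (x * (x * x))) * ((x * (x * x)) * (x * (x * x))))] (mod 8191)"
    unfolding coset_key_def mersenne_square_def
    by (intro mersenne_mult_cong cong_refl)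
  moreover have "x ^ 13 = x * (((x * (x * x)) * (x * (x * x))) * ((x * (x * x)) * (x * (x * x))))"
    by (simp only: eval_nat_numeral BitM.simps power_Suc power_0 mult_1_right mult.assoc)
  ultimately show ?thesis by simp
qed

lemma pair_key_cong: "[pair_key (xs, x, y) = (x + 8190 * y) ^ 13] (mod 8191)"
proof -
  have "[mersenne_fold (mersenne_fold (x + 8190 * y)) = x + 8190 * y] (mod 8191)"
    by (meson cong_trans mersenne_fold_cong)
  then show ?thesis
    unfolding pair_key_def prod.case by (meson cong_trans coset_key_cong cong_pow)
qed

lemma map_pair_key:
  "map pair_key point_pairs =
     concat (map (\<lambda>xs. concat (map (\<lambda>x. concat (map (\<lambda>y.
       if x \<noteq> y then [coset_key (mersenne_fold (mersenne_fold (x + 8190 * y)))] else [])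
       xs)) xs)) steiner_planes)"
  by (simp add: point_pairs_def pair_key_def map_concat o_def if_distrib[of "map _"] cong: if_cong)

lemma numeral_One_bits:
  "take_bit (numeral k) (numeral num.One) = (1 :: nat)"
  "drop_bit (numeral k) (numeral num.One) = (0 :: nat)"
  "drop_bit (numeral k) 1 = (0 :: nat)"
  by simp_all

text \<open>The sentinel \<open>8191\<close> records that all keys are reduced residues.\<close>

lemma sorted_pair_keys: "successively (<) (sort (map pair_key point_pairs) @ [8191])"
  by (simp only: map_pair_key steiner_planes_def list.map concat.simps append.simps
      numeral_eq_iff num.distinct num.inject zero_neq_numeral numeral_neq_zero simp_thms
      if_True if_False,
     simp only: coset_key_def mersenne_square_def mersenne_mult_def mersenne_fold_def
      take_bit_0 drop_bit_0 take_bit_numeral_1 take_bit_of_0 drop_bit_of_0 id_apply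
      take_bit_numeral_bit0 take_bit_numeral_bit1
      drop_bit_numeral_bit0 drop_bit_numeral_bit1 numeral_One_bits
      one_plus_numeral numeral_plus_one one_add_one
      pred_numeral_simps BitM.simps arith_simps mult_1_left mult_1_right
      sort_key_simps insort_eval numeral_le_iff numeral_less_iff one_le_numeral
      numeral_le_one_iff one_less_numeral_iff le_num_simps less_num_simps
      append.simps successively.simps simp_thms)

lemma set_point_pairs:
  "set point_pairs = {(xs, x, y). xs \<in> set steiner_planes \<and> x \<in> set xs \<and> y \<in> set xs \<and> x \<noteq> y}"
  by (auto simp: point_pairs_def)

text \<open>A strictly increasing sorted list has no repetitions, and its last entry 8191 bounds all
  keys.\<close>

lemma inj_on_pair_key: "inj_on pair_key (set point_pairs)"
  and pair_key_less: "a \<in> set point_pairs \<Longrightarrow> pair_key a < 8191"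
proof -
  have "sorted_wrt (<) (sort (map pair_key point_pairs) @ [8191])"
    using sorted_pair_keys by (simp add: successively_conv_sorted_wrt)
  then have "sorted_wrt (<) (sort (map pair_key point_pairs))"
    and less: "\<forall>k\<in>set (sort (map pair_key point_pairs)). k < 8191"
    by (simp_all add: sorted_wrt_append)
  then have "distinct (map pair_key point_pairs)"
    by (metis distinct_sort strict_sorted_iff)
  then show "inj_on pair_key (set point_pairs)"
    by (simp add: distinct_map)
  show "a \<in> set point_pairs \<Longrightarrow> pair_key a < 8191"
    using less by simp
qed

text \<open>As 2^13 = 8192 is 1 modulo 8191, the factors \<open>2 ^ t\<close> and
  \<open>2 ^ u\<close> disappear in the thirteenth power. The keys are thus congruent, hence equal
  as reduced residues, and distinct pairs have distinct keys.\<close>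

lemma log_quotient_inj:
  assumes "xs \<in> set steiner_planes" "x \<in> set xs" "x' \<in> set xs" "x \<noteq> x'"
    and "ys \<in> set steiner_planes" "y \<in> set ys" "y' \<in> set ys" "y \<noteq> y'"
    and "[2 ^ t * (x + 8190 * x') = 2 ^ u * (y + 8190 * y')] (mod 8191)"
  shows "xs = ys \<and> x = y \<and> x' = y'"
proof -
  have pow: "[(2 ^ t * z) ^ 13 = z ^ 13] (mod 8191)" for t z :: nat
  proof -
    have "[(2 ^ 13) ^ t * z ^ 13 = 1 ^ t * z ^ 13] (mod (8191 :: nat))"
      by (intro cong_mult cong_pow cong_refl) (simp add: cong_def)
    moreover have "(2 ^ t * z) ^ 13 = (2 ^ 13) ^ t * z ^ 13"
      by (simp only: power_mult_distrib power_mult [symmetric] mult.commute)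
    ultimately show ?thesis by (simp only: power_one mult_1_left)
  qed
  have "[pair_key (xs, x, x') = pair_key (ys, y, y')] (mod 8191)"
    using cong_pow[OF assms(9), of 13] pow pair_key_cong by (meson cong_sym cong_trans)
  moreover have in_pairs: "(xs, x, x') \<in> set point_pairs" "(ys, y, y') \<in> set point_pairs"
    using assms by (auto simp: set_point_pairs)
  ultimately have "pair_key (xs, x, x') = pair_key (ys, y, y')"
    using pair_key_less by (metis cong_less_modulus_unique_nat)
  with inj_on_pair_key in_pairs have "(xs, x, x') = (ys, y, y')"
    by (metis inj_onD)
  then show ?thesis by simp
qed

section \<open>The orbits of the base planes form a packing\<close>

lemma steiner_planes_less: "xs \<in> set steiner_planes \<Longrightarrow> x \<in> set xs \<Longrightarrow> x < 8191"
proof -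
  have "\<forall>xs\<in>set steiner_planes. \<forall>x\<in>set xs. x < 8191"
    by (simp add: steiner_planes_def)
  then show "xs \<in> set steiner_planes \<Longrightarrow> x \<in> set xs \<Longrightarrow> x < 8191" by blast
qed

lemma distinct_steiner_planes: "distinct steiner_planes"
  by (simp add: steiner_planes_def)

lemma length_steiner_planes: "length steiner_planes = 15"
  by (simp add: steiner_planes_def)

lemma power_2_less_8191: "t < 13 \<Longrightarrow> 2 ^ t < (8191 :: nat)"
  using power_increasing[of t 12 "2 :: nat"] by simp

text \<open>The image of the base plane \<open>xs\<close> under the \<open>t\<close>-th Frobenius
  power followed by multiplication by \<open>\<alpha>^n\<close>. The zero vector has no logarithm
  and is added separately.\<close>

definition steiner_plane :: "nat \<times> nat \<times> nat list \<Rightarrow> (nat \<Rightarrow> bit) set" where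
  "steiner_plane = (\<lambda>(n, t, xs). insert 0 (set (map (\<lambda>l. singer (n + 2 ^ t * l)) xs)))"

lemma steiner_plane_eq_plane:
  assumes "xs \<in> set steiner_planes"
  shows "\<exists>a b c. indep a b c \<and> steiner_plane (n, t, xs) = plane a b c"
proof -
  have "fano (map (\<lambda>l. singer (n + 2 ^ t * l)) xs)"
    by (rule fano_map[of singer]) (use fano_steiner_planes assms singer_add_frobenius in blast)+
  moreover have "0 \<notin> set (map (\<lambda>l. singer (n + 2 ^ t * l)) xs)"
    using singer_neq_0 by (metis (no_types, lifting) ex_map_conv)
  ultimately show ?thesis
    unfolding steiner_plane_def prod.case by (rule fano_plane)
qed

text \<open>The quotient of \<open>u\<close> and \<open>w\<close> does not depend on the
  multipliers, so it determines the base plane and both points on it. The difference of their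
  logarithms is invertible modulo 8191, which yields first \<open>t = s\<close> and then
  \<open>n = m\<close>.\<close>

lemma steiner_plane_inj:
  assumes xs: "xs \<in> set steiner_planes" and ys: "ys \<in> set steiner_planes"
    and lt: "n < 8191" "m < 8191" "t < 13" "s < 13"
    and u: "u \<in> steiner_plane (n, t, xs)" "u \<in> steiner_plane (m, s, ys)" "u \<noteq> 0"
    and w: "w \<in> steiner_plane (n, t, xs)" "w \<in> steiner_plane (m, s, ys)" "w \<noteq> 0"
    and "u \<noteq> w"
  shows "(n, t, xs) = (m, s, ys)"
proof -
  obtain x y where x: "x \<in> set xs" "u = singer (n + 2 ^ t * x)"
    and y: "y \<in> set ys" "u = singer (m + 2 ^ s * y)"
    using u by (auto simp: steiner_plane_def)
  obtain x' y' where x': "x' \<in> set xs" "w = singer (n + 2 ^ t * x')"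
    and y': "y' \<in> set ys" "w = singer (m + 2 ^ s * y')"
    using w by (auto simp: steiner_plane_def)
  have neq: "x \<noteq> x'" "y \<noteq> y'"
    using \<open>u \<noteq> w\<close> x x' y y' by auto
  have cong: "[n + 2 ^ t * x = m + 2 ^ s * y] (mod 8191)"
    "[n + 2 ^ t * x' = m + 2 ^ s * y'] (mod 8191)"
    using x x' y y' singer_eq_imp_cong by metis+
  \<comment> \<open>The multiplier occurs \<open>1 + 8190\<close> times and so drops out modulo
    8191.\<close>
  have combine: "(k + 2 ^ r * z) + 8190 * (k + 2 ^ r * z') = 2 ^ r * (z + 8190 * z') + k * 8191"
    for k r z z' :: nat
    by (simp add: algebra_simps)
  have quot: "[2 ^ t * (x + 8190 * x') = 2 ^ s * (y + 8190 * y')] (mod 8191)"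
    using cong_add[OF cong(1) cong_scalar_left[OF cong(2), of 8190]]
    unfolding combine by (simp only: cong_def mod_mult_self1)
  from log_quotient_inj[OF xs x(1) x'(1) neq(1) ys y(1) y'(1) neq(2) quot]
  have eq: "xs = ys" "x = y" "x' = y'" by auto
  have "\<not> 8191 dvd x + 8190 * x'"
  proof
    assume "8191 dvd x + 8190 * x'"
    then have "[x + 8190 * x' + x' = 0 + x'] (mod 8191)"
      by (intro cong_add cong_refl) (simp add: cong_0_iff)
    then have "[x = x'] (mod 8191)"
      by (simp add: cong_def)
    then show False
      using neq(1) steiner_planes_less[OF xs] x(1) x'(1) by (metis cong_less_modulus_unique_nat)
  qed
  then have "coprime (x + 8190 * x') 8191"
    by (metis coprime_commute prime_8191 prime_imp_coprime)
  then have "[2 ^ t = 2 ^ s] (mod (8191 :: nat))"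
    using quot unfolding eq by (metis cong_mult_rcancel_nat)
  \<comment> \<open>Both powers are at most 2^12, so congruence is equality.\<close>
  then have "2 ^ t = (2 ^ s :: nat)"
    using power_2_less_8191 lt by (metis cong_less_modulus_unique_nat)
  then have "t = s" by simp
  with cong(1) eq have "[n = m] (mod 8191)"
    by (simp add: cong_add_rcancel_nat)
  then have "n = m" using lt by (metis cong_less_modulus_unique_nat)
  with \<open>t = s\<close> eq show ?thesis by simp
qed

lemma plane_packing_steiner:
  "plane_packing 13 ({..<8191} \<times> {..<13} \<times> set steiner_planes) steiner_plane"
  unfolding plane_packing_def
proof (intro conjI ballI impI)
  fix i assume "i \<in> {..<8191 :: nat} \<times> {..<13 :: nat} \<times> set steiner_planes"
  then obtain n t xs where i: "i = (n, t, xs)" "xs \<in> set steiner_planes" by auto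
  obtain a b c where "indep a b c" "steiner_plane i = plane a b c"
    using steiner_plane_eq_plane i by metis
  then show "fvec.subspace (steiner_plane i)" "fvec.dim (steiner_plane i) = 3"
    using subspace_plane dim_plane by metis+
  show "steiner_plane i \<subseteq> coord_space 13"
    using singer_in_coord_space fvec.subspace_0[OF subspace_coord_space]
    by (auto simp: steiner_plane_def i)
next
  fix i j u w
  assume "i \<in> {..<8191 :: nat} \<times> {..<13 :: nat} \<times> set steiner_planes"
    and "j \<in> {..<8191 :: nat} \<times> {..<13 :: nat} \<times> set steiner_planes"
    and "u \<in> steiner_plane i \<inter> steiner_plane j" "w \<in> steiner_plane i \<inter> steiner_plane j"
    and "u \<noteq> 0" "w \<noteq> 0" "u \<noteq> w"
  then show "i = j"
    by (cases i; cases j) (auto dest: steiner_plane_inj)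
qed

text \<open>The count is 1597245 = 8191 * 13 * 15: multipliers, Frobenius powers, base
  planes.\<close>

lemma max_code_size_13: "1597245 \<le> max_code_size TYPE(bit) 13 4 3"
proof -
  have "card (set steiner_planes) = 15"
    by (simp only: distinct_card[OF distinct_steiner_planes] length_steiner_planes)
  then show ?thesis
    using card_le_max_code_size[OF plane_packing_steiner] by (simp add: card_cartesian_product)
qed

section \<open>From dimension 13 to all larger dimensions\<close>

lemma max_code_size_add:
  assumes "quadratic_free n T" "N \<le> max_code_size TYPE(bit) m 4 3"
  shows "N * 4 ^ n \<le> max_code_size TYPE(bit) (m + n) 4 3"
proof -
  obtain C where C: "plane_packing m C (\<lambda>U. U)" "card C = max_code_size TYPE(bit) m 4 3"
    by (rule obtain_optimal_code)
  have "N * 4 ^ n \<le> card C * 4 ^ n" using assms(2) C(2) by simp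
  also have "\<dots> \<le> max_code_size TYPE(bit) (m + n) 4 3"
    using C(1) assms(1) by (rule linkage)
  finally show ?thesis .
qed

text \<open>Linkage by 3, 4 or 5 columns starts the induction; from \<open>k = 6\<close> on, three
  columns are appended at a time, and the factors \<open>4 ^ n\<close> multiply up.\<close>

lemma max_code_size_ge:
  assumes "k \<ge> 3"
  shows "1597245 * 4 ^ k \<le> max_code_size TYPE(bit) (13 + k) 4 3"
  using assms
proof (induction k rule: less_induct)
  case (less k)
  consider "k = 3" | "k = 4" | "k = 5" | "k \<ge> 6" using less.prems by linarith
  then show ?case
  proof cases
    case 4
    then have "1597245 * 4 ^ (k - 3) * 4 ^ 3 \<le> max_code_size TYPE(bit) (13 + (k - 3) + 3) 4 3"
      by (intro max_code_size_add[OF quadratic_free_3] less.IH) auto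
    moreover have "4 ^ k = 4 ^ (k - 3) * (4 ^ 3 :: nat)"
      using less.prems power_add[of "4 :: nat" "k - 3" 3] by simp
    ultimately show ?thesis using less.prems by simp
  qed (use max_code_size_add[OF _ max_code_size_13] quadratic_free_3 quadratic_free_4
      quadratic_free_5 in blast)+
qed

lemma q_binomial_2_2:
  "q_binomial 2 (k + 10) 2 = (2 ^ (k + 9) - 1) * (2 ^ (k + 10) - 1) / 3"
proof -
  have "(2 :: real) powi (9 + int k) = 2 ^ (k + 9)" "(2 :: real) powi (10 + int k) = 2 ^ (k + 10)"
    using power_int_of_nat[of "2 :: real" "k + 9"] power_int_of_nat[of "2 :: real" "k + 10"]
    by (simp_all add: add.commute del: power_int_of_nat)
  moreover have "{1..2 :: nat} = {1, 2}" by auto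
  ultimately show ?thesis
    by (simp add: q_binomial_def)
qed

theorem proposition11:
  fixes v :: nat
  assumes "v \<ge> 19"
  shows "real (max_code_size TYPE(bit) v 4 3) / (2 ^ (2 * v - 6) + q_binomial 2 (v - 3) 2) \<ge> 1.3056"
proof -
  obtain k where v: "v = 13 + k" "k \<ge> 3"
    using that[of "v - 13"] assms by simp
  \<comment> \<open>With \<open>v = 13 + k\<close>, the denominator is quadratic in
    \<open>2 ^ k\<close> and the lower bound is a multiple of its square.\<close>
  define X :: real where "X = 2 ^ k"
  have X: "X \<ge> 1" "X\<^sup>2 = 4 ^ k"
    by (simp_all add: X_def power2_eq_square flip: power_mult_distrib)
  have "v - 3 = k + 10" using v by simp
  then have q: "q_binomial 2 (v - 3) 2 = (512 * X - 1) * (1024 * X - 1) / 3"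
    by (simp add: q_binomial_2_2 X_def power_add mult.commute)
  have "2 * v - 6 = 20 + 2 * k" using v by simp
  then have p: "(2 :: real) ^ (2 * v - 6) = 1048576 * X\<^sup>2"
    by (simp add: X(2) power_add power_mult)
  have "real (1597245 * 4 ^ k) \<le> real (max_code_size TYPE(bit) v 4 3)"
    using max_code_size_ge[OF v(2)] v(1) by (simp only: of_nat_le_iff)
  then have A: "1597245 * X\<^sup>2 \<le> real (max_code_size TYPE(bit) v 4 3)"
    by (simp add: X(2))
  have pos: "0 < 1048576 * X\<^sup>2 + (512 * X - 1) * (1024 * X - 1) / 3"
    using X(1) by (intro add_pos_nonneg) auto
  have "X \<le> X\<^sup>2" using X(1) by (simp add: power2_eq_square)
  moreover have "(512 * X - 1) * (1024 * X - 1) = 524288 * X\<^sup>2 - 1536 * X + 1"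
    by (simp add: algebra_simps power2_eq_square)
  \<comment> \<open>The coefficient of \<open>X\<^sup>2\<close> on the left is about 1597190.96,
    just below 1597245, and the remaining terms, a positive multiple of \<open>1 - 1536 * X\<close>,
    are negative.\<close>
  ultimately have "1.3056 * (1048576 * X\<^sup>2 + (512 * X - 1) * (1024 * X - 1) / 3) \<le> 1597245 * X\<^sup>2"
    using X(1) by simp
  with A pos show ?thesis
    unfolding p q by (simp add: le_divide_eq)
qed

end
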